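(* Let $U$ be a finite set, let $m\ge 1$ be an integer, let $h:U\to\{0,\ldots,m-1\}$ be a random 2-independent hash function, and let $t$ be uniform in $\{0,\ldots,m-1\}$, independent of $h$. Define $\mathit{Sample}(x)=1$ if $h(x)\le t$ and $0$ otherwise. Then for every commutative monoid $R$ and every function $v:U\to R$ such that the set $S=\{x\in U\mid v(x)\neq 0\}$ has $n=|S|\ge 1$ elements, \[\Pr_{h,t}\Big[\sum\{v(x)\mid x\in U,\ \mathit{Sample}(x)=1\}\neq 0\Big]\ \ge\ (1-n^2/m^2)/8.\]
   Context: A random hash function $h:U\to\{0,\ldots,m-1\}$ is 2-independent if for any two distinct keys $x_1,x_2\in U$ and any $t_1,t_2\in\{0,\ldots,m-1\}$, $\Pr[h(x_1)=t_1\wedge h(x_2)=t_2]=1/m^2$. A commutative monoid is a set with a commutative, associative addition having a neutral element $0$; the sum is taken in $R$ (empty sum is $0$).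
   Formalization: When U has a single key, 2-independence is vacuous and the claim can fail (m=9, h(x)=8 always), so in that case the formal theorem additionally assumes that h(x) is uniform in {0,…,m-1}. *)

theory Defs
  imports "HOL-Probability.Probability"
begin

text \<open>
  The distribution of a random hash function lives on the functions from U to {0..m-1}; values of
  \<open>h \<omega>\<close> outside U are junk, hence the restriction.
\<close>

definition hash_space :: "'k set \<Rightarrow> nat \<Rightarrow> ('k \<Rightarrow> nat) measure" where
  "hash_space U m = Pi\<^sub>M U (\<lambda>_. count_space {..<m})"

definition random_hash :: "'w measure \<Rightarrow> 'k set \<Rightarrow> nat \<Rightarrow> ('w \<Rightarrow> 'k \<Rightarrow> nat) \<Rightarrow> bool" where
  "random_hash M U m h \<longleftrightarrow> (\<lambda>\<omega>. restrict (h \<omega>) U) \<in> measurable M (hash_space U m)"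

definition two_independent :: "'w measure \<Rightarrow> 'k set \<Rightarrow> nat \<Rightarrow> ('w \<Rightarrow> 'k \<Rightarrow> nat) \<Rightarrow> bool" where
  "two_independent M U m h \<longleftrightarrow>
     (\<forall>x\<^sub>1\<in>U. \<forall>x\<^sub>2\<in>U. x\<^sub>1 \<noteq> x\<^sub>2 \<longrightarrow>
       (\<forall>t\<^sub>1<m. \<forall>t\<^sub>2<m.
          measure M {\<omega> \<in> space M. h \<omega> x\<^sub>1 = t\<^sub>1 \<and> h \<omega> x\<^sub>2 = t\<^sub>2} = 1 / (real m)\<^sup>2))"

text \<open>
  The library's \<open>indep_var\<close> requires both random variables to have values in the same type;
  this is the same notion (independence of the generated sigma-algebras) for different value types.
\<close>

definition indep_rv :: "'w measure \<Rightarrow> 'a measure \<Rightarrow> ('w \<Rightarrow> 'a) \<Rightarrow> 'b measure \<Rightarrow> ('w \<Rightarrow> 'b) \<Rightarrow> bool" where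
  "indep_rv M A X B Y \<longleftrightarrow>
     X \<in> measurable M A \<and> Y \<in> measurable M B \<and>
     prob_space.indep_set M {X -` S \<inter> space M |S. S \<in> sets A} {Y -` S \<inter> space M |S. S \<in> sets B}"

definition Sample :: "('k \<Rightarrow> nat) \<Rightarrow> nat \<Rightarrow> 'k \<Rightarrow> nat" where
  "Sample h t x = (if h x \<le> t then 1 else 0)"

end

theory Submission
  imports Defs
begin

text \<open>
  Write \<open>F s\<close> for the sum of \<open>v\<close> over the keys with hash value at most \<open>s\<close>. If exactly one key of
  the support of \<open>v\<close> has its hash value in the window \<open>(s - d, s]\<close>, then \<open>F s\<close> is \<open>F (s - d)\<close> plus a
  nonzero value, so \<open>F s\<close> and \<open>F (s - d)\<close> are not both zero (where \<open>F\<close> vanishes at negative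
  arguments). Hence the expected number of \<open>s < m\<close> with \<open>F s \<noteq> 0\<close> is at least half the expected
  number of windows that contain exactly one such key. If \<open>c\<close> is the number of keys in a window,
  then \<open>c = 1\<close> has indicator at least \<open>2 * c - c\<^sup>2\<close>, whose expectation is determined by
  2-independence: for a window of \<open>w\<close> values and \<open>p = w / m\<close> it equals \<open>n * p - n * (n - 1) * p\<^sup>2\<close>.
  With \<open>d\<close> the integer nearest to \<open>m / (2 * n)\<close>, the main part \<open>n * p - (n * p)\<^sup>2\<close> is at least
  \<open>(1 - n\<^sup>2 / m\<^sup>2) / 4\<close>, and the remaining \<open>n * p\<^sup>2\<close> compensates for the windows cut off at 0.
\<close>

section \<open>Counting windows for a fixed hash function\<close>

lemma singleton_window_sum_nonzero:
  fixes v :: "'k \<Rightarrow> 'r :: comm_monoid_add" and H :: "'k \<Rightarrow> nat"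
  assumes "finite U"
    and one: "{x \<in> U. v x \<noteq> 0 \<and> H x \<le> s \<and> s < H x + d} = {a}"
  shows "(\<Sum>x | x \<in> U \<and> H x \<le> s. v x) \<noteq> 0 \<or>
         d \<le> s \<and> (\<Sum>x | x \<in> U \<and> H x \<le> s - d. v x) \<noteq> 0"
proof -
  \<comment> \<open>Writing \<open>H x + d \<le> s\<close> rather than
    \<open>H x \<le> s - d\<close> makes \<open>?lo\<close> empty when \<open>s < d\<close>, as
    truncated subtraction would not.\<close>
  let ?lo = "{x \<in> U. H x + d \<le> s}" and ?win = "{x \<in> U. H x \<le> s \<and> s < H x + d}"
  have a: "a \<in> U" "v a \<noteq> 0"
    using one by auto
  have "{x. x \<in> U \<and> H x \<le> s} = ?lo \<union> ?win"
    by auto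
  then have "(\<Sum>x | x \<in> U \<and> H x \<le> s. v x) = sum v ?lo + sum v ?win"
    using assms(1) by (simp add: sum.union_disjoint disjoint_iff)
  also have "sum v ?win = sum v {a}"
    using one assms(1) by (intro sum.mono_neutral_right) auto
  finally have split: "(\<Sum>x | x \<in> U \<and> H x \<le> s. v x) = sum v ?lo + v a"
    by simp
  \<comment> \<open>A monoid has no subtraction, so the case split replaces it: if the lower sum is
    0, the full sum is exactly \<open>v a\<close>; otherwise the lower sum is itself the nonzero
    one.\<close>
  show ?thesis
  proof (cases "sum v ?lo = 0")
    case True
    then show ?thesis using split a by simp
  next
    case False
    then have "?lo \<noteq> {}" by force
    then have "d \<le> s" by auto
    then have "?lo = {x. x \<in> U \<and> H x \<le> s - d}" by auto
    then show ?thesis using False \<open>d \<le> s\<close> by simp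
  qed
qed

text \<open>Each threshold below \<open>m\<close> is the lower end \<open>s - d\<close> of at most
  one window. Together with its use as an upper end it is counted at most twice, whence the factor 2
  in the next lemma.\<close>

lemma sum_of_bool_shift_le:
  fixes m d :: nat
  shows "(\<Sum>s<m. of_bool (d \<le> s \<and> Q (s - d))) \<le> (\<Sum>s<m. of_bool (Q s) :: real)"
proof -
  have "card {s\<in>{..<m}. d \<le> s \<and> Q (s - d)} \<le> card {s\<in>{..<m}. Q s}"
    by (rule card_inj_on_le[where f = "\<lambda>s. s - d"]) (auto simp: inj_on_def)
  then show ?thesis
    by (simp add: of_bool_def sum.If_cases Int_def)
qed

lemma window_counts_le_nonzero_sums:
  fixes v :: "'k \<Rightarrow> 'r :: comm_monoid_add" and H :: "'k \<Rightarrow> nat" and d m :: nat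
  assumes "finite U"
  defines "c \<equiv> \<lambda>s. real (card {x \<in> U. v x \<noteq> 0 \<and> H x \<le> s \<and> s < H x + d})"
  shows "(\<Sum>s<m. 2 * c s - (c s)\<^sup>2) \<le>
         2 * (\<Sum>s<m. of_bool ((\<Sum>x | x \<in> U \<and> H x \<le> s. v x) \<noteq> 0))"
proof -
  define Q where "Q s \<longleftrightarrow> (\<Sum>x | x \<in> U \<and> H x \<le> s. v x) \<noteq> 0" for s
  have "2 * c s - (c s)\<^sup>2 \<le> of_bool (Q s) + of_bool (d \<le> s \<and> Q (s - d))" for s
  proof (cases "card {x \<in> U. v x \<noteq> 0 \<and> H x \<le> s \<and> s < H x + d} = 1")
    case True
    then obtain a where "{x \<in> U. v x \<noteq> 0 \<and> H x \<le> s \<and> s < H x + d} = {a}"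
      by (auto simp: card_1_singleton_iff)
    from singleton_window_sum_nonzero[OF assms(1) this] have "Q s \<or> d \<le> s \<and> Q (s - d)"
      by (simp add: Q_def)
    then show ?thesis using True by (auto simp: c_def)
  next
    case False
    \<comment> \<open>Integrality of the count: no value lies strictly between 0 and 2 except the
      excluded 1.\<close>
    then have "c s = 0 \<or> 2 \<le> c s"
      unfolding c_def by linarith
    then have "c s * (2 - c s) \<le> 0"
      by (auto simp: mult_le_0_iff)
    then have "2 * c s - (c s)\<^sup>2 \<le> 0"
      by (simp add: power2_eq_square algebra_simps)
    then show ?thesis
      by (rule order_trans) simp
  qed
  then have "(\<Sum>s<m. 2 * c s - (c s)\<^sup>2) \<le>
      (\<Sum>s<m. of_bool (Q s) + of_bool (d \<le> s \<and> Q (s - d)))"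
    by (rule sum_mono)
  also have "\<dots> \<le> 2 * (\<Sum>s<m. of_bool (Q s))"
    using sum_of_bool_shift_le[of d Q m] by (simp add: sum.distrib)
  finally show ?thesis by (simp add: Q_def)
qed

section \<open>Choice of the window length and the loss at the cut-off windows\<close>

lemma sum_truncated_windows_ge:
  fixes m n :: nat
  assumes "1 \<le> n" and "1 \<le> m"
  defines "d \<equiv> (m + n) div (2 * n)"
  defines "w \<equiv> \<lambda>s. min (Suc s) d"
  shows "real m * ((1 - (real n)\<^sup>2 / (real m)\<^sup>2) / 4) \<le>
    (\<Sum>s<m. real n * (real (w s) / real m) -
        real n * (real n - 1) * (real (w s) / real m)\<^sup>2)"
proof -
  define g where "g x = real n * (x / real m) - real n * (real n - 1) * (x / real m)\<^sup>2" for x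
  define Q where "Q = (1 - (real n)\<^sup>2 / (real m)\<^sup>2) / 4"
  have m: "real m > 0" using assms by simp
  have "2 * n * d \<le> m + n"
    unfolding d_def by simp
  moreover have "m + n < 2 * n * d + 2 * n"
    using dividend_less_div_times[of "2 * n" "m + n"] assms(1)
    by (simp add: d_def algebra_simps)
  ultimately have "real (2 * n * d) \<le> real (m + n)" "real (m + n) \<le> real (2 * n * d + 2 * n)"
    by (simp_all only: of_nat_le_iff)
  \<comment> \<open>Rounding error: the multiple \<open>2 * n * d\<close> of \<open>2 * n\<close>
    nearest to \<open>m\<close> is at distance at most \<open>n\<close>.\<close>
  then have "\<bar>2 * real n * real d - real m\<bar> \<le> \<bar>real n\<bar>"
    by simp
  then have "(2 * real n * real d - real m)\<^sup>2 \<le> (real n)\<^sup>2"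
    by (simp only: abs_le_square_iff)
  then have "0 \<le> ((real n)\<^sup>2 - (2 * real n * real d - real m)\<^sup>2) / (4 * (real m)\<^sup>2)"
    by simp
  \<comment> \<open>Completing the square: with \<open>p = d / m\<close>,
    \<open>n * p - (n * p)^2 = 1/4 - (2 * n * d - m)^2 / (4 * m^2)\<close>.\<close>
  also have "\<dots> = g (real d) - (Q + real n * (real d / real m)\<^sup>2)"
    using m by (simp add: Q_def g_def field_simps power2_eq_square)
  finally have gd: "Q + real n * (real d / real m)\<^sup>2 \<le> g (real d)"
    by simp
  have loss: "g (real d) - real n / real m * real (d - Suc s) \<le> g (real (w s))" for s
  proof -
    \<comment> \<open>Shortening a window only helps the subtracted quadratic term, so the loss is
      at most that of the linear term. The deficit \<open>d - Suc s\<close> is 0 for full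
      windows.\<close>
    have "(real (w s) / real m)\<^sup>2 \<le> (real d / real m)\<^sup>2"
      by (intro power_mono divide_right_mono) (auto simp: w_def)
    then have "real n * (real n - 1) * (real (w s) / real m)\<^sup>2 \<le>
        real n * (real n - 1) * (real d / real m)\<^sup>2"
      using assms(1) by (intro mult_left_mono) auto
    moreover have diff: "real (d - Suc s) = real d - real (w s)"
      by (auto simp: w_def min_def of_nat_diff)
    have "real n / real m * real (d - Suc s) =
        real n * (real d / real m) - real n * (real (w s) / real m)"
      unfolding diff by (simp add: algebra_simps)
    ultimately show ?thesis
      unfolding g_def by linarith
  qed
  \<comment> \<open>The crude bound \<open>d^2\<close> on the total deficit suffices:
    \<open>n / m * d^2\<close> is exactly \<open>m\<close> times the reserve
    \<open>n * (d / m)^2\<close> kept in \<open>gd\<close>.\<close>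
  have "(\<Sum>s<m. d - Suc s) = (\<Sum>s\<in>{..<m} \<inter> {..<d}. d - Suc s)"
    by (rule sum.mono_neutral_right) auto
  also have "\<dots> \<le> (\<Sum>s<d. d - Suc s)"
    by (rule sum_mono2) auto
  also have "\<dots> \<le> (\<Sum>s<d. d)"
    by (rule sum_mono) simp
  finally have "(\<Sum>s<m. d - Suc s) \<le> d\<^sup>2"
    by (simp add: power2_eq_square)
  then have D: "(\<Sum>s<m. real (d - Suc s)) \<le> (real d)\<^sup>2"
    by (metis of_nat_sum of_nat_power of_nat_le_iff)
  have "real m * Q \<le> real m * (g (real d) - real n * (real d / real m)\<^sup>2)"
    using gd by (intro mult_left_mono) auto
  also have "\<dots> = real m * g (real d) - real n / real m * (real d)\<^sup>2"
    using m by (simp add: field_simps power2_eq_square)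
  also have "\<dots> \<le> real m * g (real d) - real n / real m * (\<Sum>s<m. real (d - Suc s))"
    using D by (intro diff_left_mono mult_left_mono) auto
  also have "\<dots> = (\<Sum>s<m. g (real d) - real n / real m * real (d - Suc s))"
    by (simp add: sum_subtractf sum_distrib_left)
  also have "\<dots> \<le> (\<Sum>s<m. g (real (w s)))"
    using loss by (rule sum_mono)
  finally show ?thesis by (simp add: Q_def g_def)
qed

section \<open>Events and moments of a 2-independent hash function\<close>

lemma (in prob_space) random_hash_event:
  assumes "finite U" and "random_hash M U m h"
    and "\<And>H H'. (\<And>x. x \<in> U \<Longrightarrow> H x = H' x) \<Longrightarrow> P H = P H'"
  shows "{\<omega> \<in> space M. P (h \<omega>)} \<in>
    {(\<lambda>\<omega>. restrict (h \<omega>) U) -` A \<inter> space M | A. A \<in> sets (hash_space U m)}"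
    and "{\<omega> \<in> space M. P (h \<omega>)} \<in> events"
proof -
  let ?X = "\<lambda>\<omega>. restrict (h \<omega>) U"
  have X: "?X \<in> M \<rightarrow>\<^sub>M hash_space U m"
    using assms(2) by (simp add: random_hash_def)
  \<comment> \<open>The finite product is discrete, so any property that reads only the values on
    \<open>U\<close> is the preimage of a measurable set under the restricted hash function.\<close>
  have hs: "hash_space U m = count_space (U \<rightarrow>\<^sub>E {..<m})"
    using assms(1) unfolding hash_space_def by (rule count_space_PiM_finite) simp
  have "P (?X \<omega>) = P (h \<omega>)" for \<omega>
    by (rule assms(3)) simp
  then have eq: "{\<omega> \<in> space M. P (h \<omega>)} = ?X -` {H \<in> U \<rightarrow>\<^sub>E {..<m}. P H} \<inter> space M"
    using measurable_space[OF X] by (auto simp: hs)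
  have A: "{H \<in> U \<rightarrow>\<^sub>E {..<m}. P H} \<in> sets (hash_space U m)"
    by (auto simp: hs)
  show "{\<omega> \<in> space M. P (h \<omega>)} \<in> {?X -` A \<inter> space M | A. A \<in> sets (hash_space U m)}"
    using eq A by blast
  show "{\<omega> \<in> space M. P (h \<omega>)} \<in> events"
    unfolding eq using X A by (rule measurable_sets)
qed

lemma (in prob_space) random_hash_less:
  assumes "random_hash M U m h" and "\<omega> \<in> space M" and "x \<in> U"
  shows "h \<omega> x < m"
proof -
  have "restrict (h \<omega>) U \<in> U \<rightarrow>\<^sub>E {..<m}"
    using measurable_space[OF assms(1)[unfolded random_hash_def] assms(2)]
    by (simp add: hash_space_def space_PiM)
  then show ?thesis using assms(3) by auto
qed

lemma (in prob_space) two_independent_window_pair: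
  assumes "finite U" and "random_hash M U m h" and "two_independent M U m h"
    and "x \<in> U" "y \<in> U" "x \<noteq> y" and "I \<subseteq> {..<m}" "J \<subseteq> {..<m}"
  shows "prob {\<omega> \<in> space M. h \<omega> x \<in> I \<and> h \<omega> y \<in> J} =
    real (card I) / real m * (real (card J) / real m)"
proof -
  have fin: "finite I" "finite J"
    using assms(7,8) by (auto intro: finite_subset[OF _ finite_lessThan])
  have "{\<omega> \<in> space M. h \<omega> x \<in> I \<and> h \<omega> y \<in> J} =
      (\<Union>ij\<in>I \<times> J. {\<omega> \<in> space M. h \<omega> x = fst ij \<and> h \<omega> y = snd ij})"
    by auto
  moreover have "prob \<dots> =
      (\<Sum>ij\<in>I \<times> J. prob {\<omega> \<in> space M. h \<omega> x = fst ij \<and> h \<omega> y = snd ij})"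
  proof (rule finite_measure_finite_Union)
    show "(\<lambda>ij. {\<omega> \<in> space M. h \<omega> x = fst ij \<and> h \<omega> y = snd ij}) ` (I \<times> J) \<subseteq> events"
      using assms(4,5) by (intro image_subsetI random_hash_event(2)[OF assms(1,2)]) simp
  qed (use fin in \<open>auto simp: disjoint_family_on_def\<close>)
  moreover have "\<dots> = (\<Sum>ij\<in>I \<times> J. 1 / (real m)\<^sup>2)"
    using assms(3-8) by (intro sum.cong refl) (auto simp: two_independent_def subset_eq)
  ultimately show ?thesis
    using fin by (simp add: card_cartesian_product power2_eq_square)
qed

text \<open>A second key that ranges over all hash values turns the pair probabilities into the
  marginal. If \<open>U\<close> has one element, 2-independence is vacuous and
  \<open>single_key\<close> supplies uniformity.\<close>

lemma (in prob_space) two_independent_window: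
  assumes "finite U" and "random_hash M U m h" and "two_independent M U m h" and "1 \<le> m"
    and single_key: "\<And>x s. U = {x} \<Longrightarrow> s < m \<Longrightarrow> prob {\<omega> \<in> space M. h \<omega> x = s} = 1 / real m"
    and "x \<in> U" and "I \<subseteq> {..<m}"
  shows "prob {\<omega> \<in> space M. h \<omega> x \<in> I} = real (card I) / real m"
proof (cases "U = {x}")
  case True
  have fin: "finite I"
    using assms(7) by (rule finite_subset) simp
  have "{\<omega> \<in> space M. h \<omega> x \<in> I} = (\<Union>i\<in>I. {\<omega> \<in> space M. h \<omega> x = i})"
    by auto
  moreover have "prob \<dots> = (\<Sum>i\<in>I. prob {\<omega> \<in> space M. h \<omega> x = i})"
  proof (rule finite_measure_finite_Union)
    show "(\<lambda>i. {\<omega> \<in> space M. h \<omega> x = i}) ` I \<subseteq> events"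
      using assms(6) by (intro image_subsetI random_hash_event(2)[OF assms(1,2)]) simp
  qed (use fin in \<open>auto simp: disjoint_family_on_def\<close>)
  moreover have "\<dots> = (\<Sum>i\<in>I. 1 / real m)"
    using single_key[OF True] assms(7) by (intro sum.cong refl) auto
  ultimately show ?thesis by simp
next
  case False
  then obtain y where y: "y \<in> U" "x \<noteq> y"
    using assms(6) by blast
  have "{\<omega> \<in> space M. h \<omega> x \<in> I} = {\<omega> \<in> space M. h \<omega> x \<in> I \<and> h \<omega> y \<in> {..<m}}"
    using random_hash_less[OF assms(2) _ y(1)] by auto
  then show ?thesis
    using two_independent_window_pair[OF assms(1-3,6) y assms(7), of "{..<m}"] assms(4) by simp
qed

text \<open>\<open>has_bochner_integral\<close> carries integrability and value together, so
  linearity later gives both at once.\<close>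

lemma (in prob_space) has_bochner_integral_of_bool:
  assumes "{\<omega> \<in> space M. P \<omega>} \<in> events"
  shows "has_bochner_integral M (\<lambda>\<omega>. of_bool (P \<omega>)) (prob {\<omega> \<in> space M. P \<omega>})"
proof -
  have "has_bochner_integral M (indicator {\<omega> \<in> space M. P \<omega>}) (prob {\<omega> \<in> space M. P \<omega>})"
    using assms by (intro has_bochner_integral_real_indicator) (auto simp: less_top[symmetric])
  then show ?thesis
    by (rule has_bochner_integral_cong[THEN iffD1, rotated -1]) (auto simp: indicator_def)
qed

text \<open>The square counts ordered pairs of keys: each diagonal pair contributes
  \<open>p\<close>, each other pair \<open>p^2\<close>. The diagonal cancels one of the two copies
  of the linear term.\<close>

lemma (in prob_space) two_independent_window_count:
  assumes "finite U" and "random_hash M U m h" and "two_independent M U m h" and "1 \<le> m"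
    and "\<And>x s. U = {x} \<Longrightarrow> s < m \<Longrightarrow> prob {\<omega> \<in> space M. h \<omega> x = s} = 1 / real m"
    and "S \<subseteq> U" and "I \<subseteq> {..<m}"
  defines "c \<equiv> \<lambda>\<omega>. real (card {x \<in> S. h \<omega> x \<in> I})" and "p \<equiv> real (card I) / real m"
  shows "has_bochner_integral M (\<lambda>\<omega>. 2 * c \<omega> - (c \<omega>)\<^sup>2)
    (real (card S) * p - real (card S) * (real (card S) - 1) * p\<^sup>2)"
proof -
  have fin: "finite S"
    using assms(6,1) by (rule finite_subset)
  have c: "c \<omega> = (\<Sum>x\<in>S. of_bool (h \<omega> x \<in> I))" for \<omega>
    using fin by (simp add: c_def of_bool_def sum.If_cases Int_def)
  have c2: "(c \<omega>)\<^sup>2 = (\<Sum>x\<in>S. \<Sum>y\<in>S. of_bool (h \<omega> x \<in> I \<and> h \<omega> y \<in> I))" for \<omega>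
    by (simp add: c power2_eq_square sum_product of_bool_conj)
  have 1: "has_bochner_integral M (\<lambda>\<omega>. of_bool (h \<omega> x \<in> I)) p" if "x \<in> S" for x
  proof -
    have "x \<in> U" using that assms(6) by blast
    have "{\<omega> \<in> space M. h \<omega> x \<in> I} \<in> events"
      using \<open>x \<in> U\<close> by (intro random_hash_event(2)[OF assms(1,2)]) auto
    from has_bochner_integral_of_bool[OF this] show ?thesis
      using two_independent_window[OF assms(1-5) \<open>x \<in> U\<close> assms(7)] by (simp add: p_def)
  qed
  have 2: "has_bochner_integral M (\<lambda>\<omega>. of_bool (h \<omega> x \<in> I \<and> h \<omega> y \<in> I))
      (if x = y then p else p\<^sup>2)" if "x \<in> S" "y \<in> S" for x y
  proof (cases "x = y")
    case True
    then show ?thesis using 1[OF that(1)] by simp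
  next
    case False
    have xy: "x \<in> U" "y \<in> U" using that assms(6) by auto
    have "{\<omega> \<in> space M. h \<omega> x \<in> I \<and> h \<omega> y \<in> I} \<in> events"
      using xy by (intro random_hash_event(2)[OF assms(1,2)]) auto
    from has_bochner_integral_of_bool[OF this] show ?thesis
      using two_independent_window_pair[OF assms(1-3) xy False assms(7,7)] False
      by (simp add: p_def power2_eq_square)
  qed
  have "has_bochner_integral M (\<lambda>\<omega>. 2 * c \<omega> - (c \<omega>)\<^sup>2)
      (2 * (\<Sum>x\<in>S. p) - (\<Sum>x\<in>S. \<Sum>y\<in>S. if x = y then p else p\<^sup>2))"
    \<comment> \<open>The order matters: \<open>c\<close> first would rewrite inside the square and
      hide the double sum.\<close>
    unfolding c2 unfolding c
    by (intro has_bochner_integral_diff has_bochner_integral_mult_right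
        has_bochner_integral_sum 1 2)
  moreover have "(\<Sum>y\<in>S. if x = y then p else p\<^sup>2) = p + (real (card S) - 1) * p\<^sup>2"
    if "x \<in> S" for x
  proof -
    have "(\<Sum>y\<in>S. if x = y then p else p\<^sup>2) = (\<Sum>y\<in>S. p\<^sup>2 + (if x = y then p - p\<^sup>2 else 0))"
      by (intro sum.cong) auto
    then show ?thesis
      using fin that by (simp add: sum.distrib algebra_simps)
  qed
  ultimately show ?thesis
    by (simp add: algebra_simps)
qed

lemma card_window:
  fixes s d m :: nat
  assumes "s < m"
  shows "card {j \<in> {..<m}. j \<le> s \<and> s < j + d} = min (Suc s) d"
proof -
  \<comment> \<open>Truncated subtraction in \<open>Suc s - d\<close> cuts the window off at
    0.\<close>
  have "{j \<in> {..<m}. j \<le> s \<and> s < j + d} = {Suc s - d..<Suc s}"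
    using assms by auto
  then show ?thesis by simp
qed

section \<open>Expectation over the hash function and averaging over the threshold\<close>

lemma (in prob_space) sum_prob_threshold_sum_nonzero:
  fixes v :: "'k \<Rightarrow> 'r :: comm_monoid_add"
  assumes "finite U" and "random_hash M U m h" and "two_independent M U m h" and "1 \<le> m"
    and "\<And>x s. U = {x} \<Longrightarrow> s < m \<Longrightarrow> prob {\<omega> \<in> space M. h \<omega> x = s} = 1 / real m"
    and n: "n = card {x \<in> U. v x \<noteq> 0}" "1 \<le> n"
  shows "real m * ((1 - (real n)\<^sup>2 / (real m)\<^sup>2) / 8) \<le>
    (\<Sum>s<m. prob {\<omega> \<in> space M. (\<Sum>x | x \<in> U \<and> h \<omega> x \<le> s. v x) \<noteq> 0})"
proof -
  define d where "d = (m + n) div (2 * n)"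
  define c where "c s \<omega> = real (card {x \<in> U. v x \<noteq> 0 \<and> h \<omega> x \<le> s \<and> s < h \<omega> x + d})" for s \<omega>
  define p where "p s = real (min (Suc s) d) / real m" for s
  have c: "has_bochner_integral M (\<lambda>\<omega>. 2 * c s \<omega> - (c s \<omega>)\<^sup>2)
      (real n * p s - real n * (real n - 1) * (p s)\<^sup>2)" if "s < m" for s
  proof -
    let ?I = "{j \<in> {..<m}. j \<le> s \<and> s < j + d}" and ?S = "{x \<in> U. v x \<noteq> 0}"
    have "has_bochner_integral M
        (\<lambda>\<omega>. 2 * real (card {x \<in> ?S. h \<omega> x \<in> ?I}) - (real (card {x \<in> ?S. h \<omega> x \<in> ?I}))\<^sup>2)
        (real n * p s - real n * (real n - 1) * (p s)\<^sup>2)"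
      using two_independent_window_count[OF assms(1-5), of ?S ?I]
      unfolding card_window[OF that] p_def n(1) by fastforce
    \<comment> \<open>Hash values are known to be below \<open>m\<close> only on
      \<open>space M\<close>, so the two counts are identified there and the integrals by
      congruence.\<close>
    moreover have "card {x \<in> ?S. h \<omega> x \<in> ?I} =
        card {x \<in> U. v x \<noteq> 0 \<and> h \<omega> x \<le> s \<and> s < h \<omega> x + d}" if "\<omega> \<in> space M" for \<omega>
      using random_hash_less[OF assms(2) that] by (intro arg_cong[where f = card]) auto
    ultimately show ?thesis
      by (subst has_bochner_integral_cong[OF refl _ refl]) (auto simp: c_def)
  qed
  have F: "has_bochner_integral M (\<lambda>\<omega>. of_bool ((\<Sum>x | x \<in> U \<and> h \<omega> x \<le> s. v x) \<noteq> 0))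
      (prob {\<omega> \<in> space M. (\<Sum>x | x \<in> U \<and> h \<omega> x \<le> s. v x) \<noteq> 0})" for s
  proof (intro has_bochner_integral_of_bool random_hash_event(2)[OF assms(1,2)])
    fix H H' :: "'k \<Rightarrow> nat"
    assume "\<And>x. x \<in> U \<Longrightarrow> H x = H' x"
    then have "{x. x \<in> U \<and> H x \<le> s} = {x. x \<in> U \<and> H' x \<le> s}" by auto
    then show "((\<Sum>x | x \<in> U \<and> H x \<le> s. v x) \<noteq> 0) = ((\<Sum>x | x \<in> U \<and> H' x \<le> s. v x) \<noteq> 0)"
      by simp
  qed
  have "real m * ((1 - (real n)\<^sup>2 / (real m)\<^sup>2) / 4) \<le>
      (\<Sum>s<m. real n * p s - real n * (real n - 1) * (p s)\<^sup>2)"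
    using sum_truncated_windows_ge[OF n(2) assms(4)] by (simp add: p_def d_def)
  \<comment> \<open>The bound for a fixed hash function is integrated over \<open>M\<close>; its
    factor 2 turns 1/4 into 1/8.\<close>
  also have "\<dots> \<le> 2 * (\<Sum>s<m. prob {\<omega> \<in> space M. (\<Sum>x | x \<in> U \<and> h \<omega> x \<le> s. v x) \<noteq> 0})"
  proof -
    have lhs: "has_bochner_integral M (\<lambda>\<omega>. \<Sum>s<m. 2 * c s \<omega> - (c s \<omega>)\<^sup>2)
        (\<Sum>s<m. real n * p s - real n * (real n - 1) * (p s)\<^sup>2)"
      by (intro has_bochner_integral_sum c) simp
    have rhs: "has_bochner_integral M
        (\<lambda>\<omega>. 2 * (\<Sum>s<m. of_bool ((\<Sum>x | x \<in> U \<and> h \<omega> x \<le> s. v x) \<noteq> 0)))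
        (2 * (\<Sum>s<m. prob {\<omega> \<in> space M. (\<Sum>x | x \<in> U \<and> h \<omega> x \<le> s. v x) \<noteq> 0}))"
      by (intro has_bochner_integral_mult_right has_bochner_integral_sum F)
    have le: "(\<Sum>s<m. 2 * c s \<omega> - (c s \<omega>)\<^sup>2) \<le>
        2 * (\<Sum>s<m. of_bool ((\<Sum>x | x \<in> U \<and> h \<omega> x \<le> s. v x) \<noteq> 0))" for \<omega>
      unfolding c_def by (rule window_counts_le_nonzero_sums[OF assms(1)])
    have "(\<integral>\<omega>. (\<Sum>s<m. 2 * c s \<omega> - (c s \<omega>)\<^sup>2) \<partial>M) \<le>
        (\<integral>\<omega>. 2 * (\<Sum>s<m. of_bool ((\<Sum>x | x \<in> U \<and> h \<omega> x \<le> s. v x) \<noteq> 0)) \<partial>M)"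
      by (intro integral_mono integrable.intros[OF lhs]
          integrable.intros[OF rhs] le)
    then show ?thesis
      by (simp only: has_bochner_integral_integral_eq[OF lhs]
          has_bochner_integral_integral_eq[OF rhs])
  qed
  finally show ?thesis by simp
qed

text \<open>Splitting by the value of \<open>t\<close> fixes the index; on each piece independence
  and uniformity contribute a factor \<open>1 / m\<close>.\<close>

lemma (in prob_space) prob_independent_uniform_index:
  assumes t: "t \<in> M \<rightarrow>\<^sub>M count_space {..<m}"
    and unif: "distr M (count_space {..<m}) t = uniform_count_measure {..<m}"
    and indep: "indep_set \<A> {t -` S \<inter> space M | S. S \<in> sets (count_space {..<m})}"
    and E: "\<And>s. s < m \<Longrightarrow> {\<omega> \<in> space M. P s \<omega>} \<in> \<A>"
  shows "prob {\<omega> \<in> space M. P (t \<omega>) \<omega>} = (\<Sum>s<m. prob {\<omega> \<in> space M. P s \<omega>}) / real m"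
proof -
  let ?B = "\<lambda>s. t -` {s} \<inter> space M"
  have prod: "prob ({\<omega> \<in> space M. P s \<omega>} \<inter> ?B s) = prob {\<omega> \<in> space M. P s \<omega>} / real m"
    if "s < m" for s
  proof -
    have "prob (?B s) = measure (distr M (count_space {..<m}) t) {s}"
      using t that by (subst measure_distr) auto
    also have "\<dots> = 1 / real m"
      using that by (subst unif, subst measure_uniform_count_measure) auto
    finally have "prob (?B s) = 1 / real m" .
    moreover have "?B s \<in> {t -` S \<inter> space M | S. S \<in> sets (count_space {..<m})}"
      using that by auto
    ultimately show ?thesis
      using indep_setD[OF indep E[OF that]] by simp
  qed
  have "\<A> \<subseteq> events"
    using indep by (auto simp: indep_set_def indep_sets_def split: bool.splits)
  then have ev: "{\<omega> \<in> space M. P s \<omega>} \<inter> ?B s \<in> events" if "s < m" for s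
    using E[OF that] measurable_sets[OF t, of "{s}"] that by auto
  have "{\<omega> \<in> space M. P (t \<omega>) \<omega>} = (\<Union>s<m. {\<omega> \<in> space M. P s \<omega>} \<inter> ?B s)"
    using measurable_space[OF t] by auto
  moreover have "prob \<dots> = (\<Sum>s<m. prob ({\<omega> \<in> space M. P s \<omega>} \<inter> ?B s))"
    using ev by (intro finite_measure_finite_Union) (auto simp: disjoint_family_on_def)
  ultimately show ?thesis
    using prod by (simp add: sum_divide_distrib)
qed

theorem theorem3:
  fixes M :: "'w measure" and U :: "'k set" and m :: nat
    and h :: "'w \<Rightarrow> 'k \<Rightarrow> nat" and t :: "'w \<Rightarrow> nat"
    and v :: "'k \<Rightarrow> 'r :: comm_monoid_add" and n :: nat
  assumes "prob_space M"
    and "finite U" and "m \<ge> 1"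
    and "random_hash M U m h" and "two_independent M U m h"
    and single_key: "\<And>x s. U = {x} \<Longrightarrow> s < m \<Longrightarrow>
          measure M {\<omega> \<in> space M. h \<omega> x = s} = 1 / real m"
    and "t \<in> measurable M (count_space {..<m})"
    and "distr M (count_space {..<m}) t = uniform_count_measure {..<m}"
    and "indep_rv M (hash_space U m) (\<lambda>\<omega>. restrict (h \<omega>) U) (count_space {..<m}) t"
    and "n = card {x \<in> U. v x \<noteq> 0}" and "n \<ge> 1"
  shows "measure M {\<omega> \<in> space M. (\<Sum>x | x \<in> U \<and> Sample (h \<omega>) (t \<omega>) x = 1. v x) \<noteq> 0}
           \<ge> (1 - (real n)\<^sup>2 / (real m)\<^sup>2) / 8"
proof -
  interpret prob_space M by fact
  have "prob {\<omega> \<in> space M. (\<Sum>x | x \<in> U \<and> h \<omega> x \<le> t \<omega>. v x) \<noteq> 0} =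
      (\<Sum>s<m. prob {\<omega> \<in> space M. (\<Sum>x | x \<in> U \<and> h \<omega> x \<le> s. v x) \<noteq> 0}) / real m"
  proof (rule prob_independent_uniform_index[OF assms(7,8)])
    show "indep_set
        {(\<lambda>\<omega>. restrict (h \<omega>) U) -` A \<inter> space M | A. A \<in> sets (hash_space U m)}
        {t -` S \<inter> space M | S. S \<in> sets (count_space {..<m})}"
      using assms(9) by (simp add: indep_rv_def)
    \<comment> \<open>For fixed \<open>s\<close> the sum reads the hash function only on
      \<open>U\<close>, so the event lies in the sigma-algebra that is independent of
      \<open>t\<close>.\<close>
    show "{\<omega> \<in> space M. (\<Sum>x | x \<in> U \<and> h \<omega> x \<le> s. v x) \<noteq> 0} \<in>
        {(\<lambda>\<omega>. restrict (h \<omega>) U) -` A \<inter> space M | A. A \<in> sets (hash_space U m)}" for s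
    proof (rule random_hash_event(1)[OF assms(2,4)])
      fix H H' :: "'k \<Rightarrow> nat"
      assume "\<And>x. x \<in> U \<Longrightarrow> H x = H' x"
      then have "{x. x \<in> U \<and> H x \<le> s} = {x. x \<in> U \<and> H' x \<le> s}" by auto
      then show "((\<Sum>x | x \<in> U \<and> H x \<le> s. v x) \<noteq> 0) = ((\<Sum>x | x \<in> U \<and> H' x \<le> s. v x) \<noteq> 0)"
        by simp
    qed
  qed
  moreover have "(Sample (h \<omega>) (t \<omega>) x = 1) = (h \<omega> x \<le> t \<omega>)" for \<omega> x
    by (simp add: Sample_def)
  ultimately show ?thesis
    using sum_prob_threshold_sum_nonzero[OF assms(2,4,5,3) single_key assms(10,11)] assms(3)
    by (simp add: pos_le_divide_eq mult.commute)
qed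

end
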